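(* Let $f_{\theta,\alpha}:\mathbb{R}^n\to\mathbb{R}^n$ be a Learned Proximal Network (LPN) with implicit regularizer $\varphi_{\theta,\alpha}$. Let $\mathbf{fid}:\mathbb{R}^n\to\mathbb{R}$ be $L_{\mathbf{fid}}$-smooth (i.e. differentiable with $L_{\mathbf{fid}}$-Lipschitz gradient, $L_{\mathbf{fid}}>0$) and bounded below, and let $0<\eta<1/L_{\mathbf{fid}}$. Let $x_0\in\mathbb{R}^n$ be arbitrary and define $$x_{k+1}\coloneqq f_{\theta,\alpha}\bigl(x_k-\eta\nabla\mathbf{fid}(x_k)\bigr),\qquad k\ge 0.$$ Set $F\coloneqq \eta\,\mathbf{fid}+\varphi_{\theta,\alpha}$. Then: (i) $F(x_k)$ is non-increasing and convergent. (ii) $\sum_{k=1}^{\infty}\|x_k-x_{k+1}\|^2<+\infty$. (iii) If $F$ is a KL function, then $\sum_{k=1}^{\infty}\|x_k-x_{k+1}\|<+\infty$ and $x_k\to x^*$, with $x^*$ a critical point of $F$.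
   Context: Norms and inner products are Euclidean. ICNN: An input convex neural network is a function $\psi_\theta:\mathbb{R}^n\to\mathbb{R}$, $\psi_\theta(x)\coloneqq z_K$, where $z_{i+1}\coloneqq\sigma(W_iz_i+H_ix+b_i)$ for $i=0,\dots,K-1$, with $W_0,z_0\equiv 0$; here $H_i,W_i$ are linear maps (of compatible dimensions, $z_K$ scalar), each $W_i$ has non-negative entries, $b_i$ are bias vectors, and the activation $\sigma:\mathbb{R}\to\mathbb{R}$ is convex and non-decreasing, applied element-wise. LPN: $f_{\theta,\alpha}:\mathbb{R}^n\to\mathbb{R}^n$ is an LPN with strong convexity modulus $\alpha$ if $0<\alpha<1$ and $f_{\theta,\alpha}(y)\in\partial\psi_\theta(y)+\alpha y$ for all $y$, where $\psi_\theta$ is an ICNN with Lipschitz activation $\sigma$ and $\partial$ is the convex subdifferential. Its potential is $\Psi_{\theta,\alpha}\coloneqq\psi_\theta+\frac{\alpha}{2}\|\cdot\|^2$ and its implicit regularizer is $\varphi_{\theta,\alpha}\coloneqq\Psi_{\theta,\alpha}^*-\frac12\|\cdot\|^2$, where $\Psi^*(y)\coloneqq\sup_x\{\langle x,y\rangle-\Psi(x)\}$ is the convex conjugate. (The function $\varphi_{\theta,\alpha}$ is real-valued and continuously differentiable.) KL: A continuously differentiable $F:\mathbb{R}^d\to\mathbb{R}$ has the KL property at $x^*\in\mathbb{R}^d$ if there exist $\zeta\in(0,+\infty]$, a neighborhood $U$ of $x^*$, and a continuous concave function $\chi:[0,\zeta)\to[0,\infty)$ such that $\chi(0)=0$, $\chi\in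 C^1((0,\zeta))$, $\chi'(s)>0$ for all $s\in(0,\zeta)$, and $\chi'(F(x)-F(x^* ))\,\|\nabla F(x)\|\ge 1$ for every $x\in U$ with $F(x^* )<F(x)<F(x^* )+\zeta$. $F$ is a KL function if it has the KL property at every point of $\mathbb{R}^d$. *)

theory Defs
  imports "HOL-Analysis.Analysis"
begin

section \<open>Convex analysis\<close>

definition subdifferential :: "('a::real_inner \<Rightarrow> real) \<Rightarrow> 'a \<Rightarrow> 'a set" where
  "subdifferential f x = {v. \<forall>y. f y \<ge> f x + inner v (y - x)}"

definition convex_conjugate :: "('a::real_inner \<Rightarrow> real) \<Rightarrow> 'a \<Rightarrow> ereal" where
  "convex_conjugate f y = (SUP x. ereal (inner x y - f x))"

section \<open>Input convex neural networks\<close>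

text \<open>
  The layer widths depend on the layer, so the hidden vectors are functions on \<open>nat\<close>, of which
  only the entries below the width of the layer matter. The vector \<open>z\<^sub>i\<close> has width
  \<open>icnn_width \<theta> i\<close>; \<open>icnn_W \<theta> i j k\<close> is the entry of \<open>W\<^sub>i\<close> in row \<open>j\<close> and column \<open>k\<close>, and
  \<open>icnn_H \<theta> i j\<close> is row \<open>j\<close> of \<open>H\<^sub>i\<close>.
\<close>

record 'n icnn =
  icnn_depth :: nat
  icnn_width :: "nat \<Rightarrow> nat"
  icnn_W :: "nat \<Rightarrow> nat \<Rightarrow> nat \<Rightarrow> real"
  icnn_H :: "nat \<Rightarrow> nat \<Rightarrow> real ^ 'n"
  icnn_b :: "nat \<Rightarrow> nat \<Rightarrow> real"
  icnn_act :: "real \<Rightarrow> real"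

definition valid_icnn :: "'n::finite icnn \<Rightarrow> bool" where
  "valid_icnn \<theta> \<longleftrightarrow>
     0 < icnn_depth \<theta> \<and> icnn_width \<theta> (icnn_depth \<theta>) = 1 \<and>
     (\<forall>j k. j < icnn_width \<theta> 1 \<longrightarrow> k < icnn_width \<theta> 0 \<longrightarrow> icnn_W \<theta> 0 j k = 0) \<and>
     (\<forall>i j k. i < icnn_depth \<theta> \<longrightarrow> j < icnn_width \<theta> (Suc i) \<longrightarrow> k < icnn_width \<theta> i \<longrightarrow>
        icnn_W \<theta> i j k \<ge> 0) \<and>
     convex_on UNIV (icnn_act \<theta>) \<and> mono (icnn_act \<theta>)"

primrec icnn_layer :: "'n::finite icnn \<Rightarrow> real ^ 'n \<Rightarrow> nat \<Rightarrow> nat \<Rightarrow> real" where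
  "icnn_layer \<theta> x 0 = (\<lambda>j. 0)"
| "icnn_layer \<theta> x (Suc i) = (\<lambda>j. icnn_act \<theta>
     ((\<Sum>k<icnn_width \<theta> i. icnn_W \<theta> i j k * icnn_layer \<theta> x i k)
       + inner (icnn_H \<theta> i j) x + icnn_b \<theta> i j))"

definition icnn_fun :: "'n::finite icnn \<Rightarrow> real ^ 'n \<Rightarrow> real" where
  "icnn_fun \<theta> x = icnn_layer \<theta> x (icnn_depth \<theta>) 0"

section \<open>Learned proximal networks\<close>

definition is_LPN :: "'n::finite icnn \<Rightarrow> real \<Rightarrow> (real ^ 'n \<Rightarrow> real ^ 'n) \<Rightarrow> bool" where
  "is_LPN \<theta> \<alpha> f \<longleftrightarrow>
     valid_icnn \<theta> \<and> (\<exists>L. L-lipschitz_on UNIV (icnn_act \<theta>)) \<and> 0 < \<alpha> \<and> \<alpha> < 1 \<and>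
     (\<forall>y. f y \<in> {v + \<alpha> *\<^sub>R y | v. v \<in> subdifferential (icnn_fun \<theta>) y})"

definition lpn_potential :: "'n::finite icnn \<Rightarrow> real \<Rightarrow> real ^ 'n \<Rightarrow> real" where
  "lpn_potential \<theta> \<alpha> x = icnn_fun \<theta> x + \<alpha> / 2 * (norm x)\<^sup>2"

text \<open>The conjugate of the potential of an LPN is finite: see \<open>convex_conjugate_lpn_finite\<close>.\<close>

definition implicit_regularizer :: "'n::finite icnn \<Rightarrow> real \<Rightarrow> real ^ 'n \<Rightarrow> real" where
  "implicit_regularizer \<theta> \<alpha> y =
     real_of_ereal (convex_conjugate (lpn_potential \<theta> \<alpha>) y) - 1 / 2 * (norm y)\<^sup>2"

lemma convex_conjugate_lpn_finite:
  assumes "is_LPN \<theta> \<alpha> f"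
  shows "\<bar>convex_conjugate (lpn_potential \<theta> \<alpha>) y\<bar> \<noteq> \<infinity>"
proof -
  define w where "w = y - f 0"
  define c where "c = (norm w)\<^sup>2 / (2 * \<alpha>) - icnn_fun \<theta> 0"
  have a: "0 < \<alpha>"
    using assms unfolding is_LPN_def by blast
  have "f 0 \<in> {v + \<alpha> *\<^sub>R 0 | v. v \<in> subdifferential (icnn_fun \<theta>) 0}"
    using assms unfolding is_LPN_def by blast
  then have "f 0 \<in> subdifferential (icnn_fun \<theta>) 0"
    by simp
  then have sub: "icnn_fun \<theta> x \<ge> icnn_fun \<theta> 0 + inner (f 0) x" for x
    by (simp add: subdifferential_def)
  have bound: "inner x y - lpn_potential \<theta> \<alpha> x \<le> c" for x
  proof -
    have "0 \<le> (norm (w - \<alpha> *\<^sub>R x))\<^sup>2 / (2 * \<alpha>)"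
      using a by simp
    also have "(norm (w - \<alpha> *\<^sub>R x))\<^sup>2 = (norm w)\<^sup>2 - 2 * \<alpha> * inner w x + \<alpha>\<^sup>2 * (norm x)\<^sup>2"
      by (simp only: power2_norm_eq_inner)
        (simp add: inner_diff_left inner_diff_right inner_commute algebra_simps power2_eq_square)
    also have "\<dots> / (2 * \<alpha>) = (norm w)\<^sup>2 / (2 * \<alpha>) - inner w x + \<alpha> / 2 * (norm x)\<^sup>2"
      using a by (simp add: field_simps power2_eq_square)
    finally show ?thesis
      using sub[of x]
      by (simp add: lpn_potential_def c_def w_def inner_diff_left inner_diff_right inner_commute)
  qed
  have "convex_conjugate (lpn_potential \<theta> \<alpha>) y \<le> ereal c"
    unfolding convex_conjugate_def using bound by (intro SUP_least) simp
  moreover have "ereal (inner 0 y - lpn_potential \<theta> \<alpha> 0) \<le> convex_conjugate (lpn_potential \<theta> \<alpha>) y"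
    unfolding convex_conjugate_def by (rule SUP_upper) simp
  ultimately show ?thesis
    by auto
qed

section \<open>Gradients, smoothness and the Kurdyka-Lojasiewicz property\<close>

text \<open>Only meaningful at points of differentiability.\<close>

definition gradient :: "('a::euclidean_space \<Rightarrow> real) \<Rightarrow> 'a \<Rightarrow> 'a" where
  "gradient F x = (THE D. GDERIV F x :> D)"

lemma gradient_eqI:
  assumes "GDERIV F x :> D"
  shows "gradient F x = D"
  unfolding gradient_def
proof (rule the_equality, rule assms)
  fix D' assume "GDERIV F x :> D'"
  with assms have "(\<lambda>h. inner h D') = (\<lambda>h. inner h D)"
    unfolding gderiv_def by (rule has_derivative_unique[rotated])
  then show "D' = D"
    by (metis inner_commute vector_eq_rdot)
qed

lemma differentiable_GDERIV_gradient:
  assumes "F differentiable (at x)"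
  shows "GDERIV F x :> gradient F x"
proof -
  obtain F' where F': "(F has_derivative F') (at x)"
    using assms unfolding differentiable_def by blast
  have "F' = (\<lambda>h. inner h (adjoint F' 1))"
    using adjoint_works[OF has_derivative_linear[OF F'], of _ 1] by auto
  with F' have "GDERIV F x :> adjoint F' 1"
    unfolding gderiv_def by simp
  then show ?thesis
    using gradient_eqI by metis
qed

definition L_smooth :: "real \<Rightarrow> ('a::euclidean_space \<Rightarrow> real) \<Rightarrow> bool" where
  "L_smooth L F \<longleftrightarrow> (\<forall>x. F differentiable (at x)) \<and> L-lipschitz_on UNIV (gradient F)"

definition continuously_differentiable :: "('a::euclidean_space \<Rightarrow> real) \<Rightarrow> bool" where
  "continuously_differentiable F \<longleftrightarrow>
     (\<forall>x. F differentiable (at x)) \<and> continuous_on UNIV (gradient F)"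

definition KL_property_at :: "('a::euclidean_space \<Rightarrow> real) \<Rightarrow> 'a \<Rightarrow> bool" where
  "KL_property_at F xs \<longleftrightarrow>
     (\<exists>(\<zeta>::ereal) U (\<phi>::real \<Rightarrow> real).
        0 < \<zeta> \<and> open U \<and> xs \<in> U \<and>
        (\<forall>s\<in>{s. 0 \<le> s \<and> ereal s < \<zeta>}. 0 \<le> \<phi> s) \<and>
        continuous_on {s. 0 \<le> s \<and> ereal s < \<zeta>} \<phi> \<and>
        concave_on {s. 0 \<le> s \<and> ereal s < \<zeta>} \<phi> \<and>
        \<phi> 0 = 0 \<and>
        \<phi> C1_differentiable_on {s. 0 < s \<and> ereal s < \<zeta>} \<and>
        (\<forall>s\<in>{s. 0 < s \<and> ereal s < \<zeta>}. 0 < deriv \<phi> s) \<and>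
        (\<forall>x\<in>U. F xs < F x \<and> ereal (F x) < ereal (F xs) + \<zeta> \<longrightarrow>
           deriv \<phi> (F x - F xs) * norm (gradient F x) \<ge> 1))"

definition KL_function :: "('a::euclidean_space \<Rightarrow> real) \<Rightarrow> bool" where
  "KL_function F \<longleftrightarrow> continuously_differentiable F \<and> (\<forall>xs. KL_property_at F xs)"

end

theory Submission
  imports Defs
begin

text \<open>
  Fenchel's equality at \<open>f y\<close> says that \<open>f y\<close> minimises \<open>\<phi> + \<parallel>\<cdot> - y\<parallel>\<^sup>2 / 2\<close>, where \<open>\<phi>\<close> is the implicit
  regularizer, so the iteration is proximal gradient descent on \<open>F\<close>. Together with the descent
  lemma this gives \<open>F (x\<^sub>k\<^sub>+\<^sub>1) + a \<parallel>x\<^sub>k - x\<^sub>k\<^sub>+\<^sub>1\<parallel>\<^sup>2 \<le> F (x\<^sub>k)\<close>, while first-order optimality gives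
  \<open>\<parallel>\<nabla>F (x\<^sub>k\<^sub>+\<^sub>1)\<parallel> \<le> b \<parallel>x\<^sub>k - x\<^sub>k\<^sub>+\<^sub>1\<parallel>\<close>. Since an ICNN with Lipschitz activation grows at most linearly,
  evaluating the supremum in the conjugate at the point itself shows that \<open>\<phi>\<close> is coercive; this
  bounds \<open>F\<close> from below and keeps the iterates bounded.

  For the KL part let \<open>x\<^sup>*\<close> be a cluster point, \<open>d\<^sub>k = \<parallel>x\<^sub>k - x\<^sub>k\<^sub>+\<^sub>1\<parallel>\<close> and \<open>r\<^sub>k = F (x\<^sub>k) - F (x\<^sup>*)\<close>.
  Concavity of the desingularising function \<open>\<psi>\<close> and AM-GM give
  \<open>2 d\<^sub>k\<^sub>+\<^sub>1 \<le> d\<^sub>k + (b / a) (\<psi> (r\<^sub>k\<^sub>+\<^sub>1) - \<psi> (r\<^sub>k\<^sub>+\<^sub>2))\<close> as long as \<open>x\<^sub>k\<^sub>+\<^sub>1\<close> lies in the KL neighbourhood.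
  Hence \<open>\<parallel>x\<^sub>k\<^sub>+\<^sub>1 - x\<^sup>*\<parallel> + d\<^sub>k + (b / a) \<psi> (r\<^sub>k\<^sub>+\<^sub>1)\<close> does not increase, which traps the iterates near
  \<open>x\<^sup>*\<close>, and \<open>d\<^sub>k\<close> is summable by telescoping.
\<close>

section \<open>Smooth functions\<close>

lemma GDERIV_imp_DERIV_line:
  assumes "GDERIV g (x + t *\<^sub>R v) :> D"
  shows "((\<lambda>t. g (x + t *\<^sub>R v)) has_real_derivative inner v D) (at t)"
proof -
  have "((\<lambda>t. x + t *\<^sub>R v) has_derivative (\<lambda>s. s *\<^sub>R v)) (at t)"
    by (auto intro!: derivative_eq_intros)
  moreover have "(g has_derivative (\<lambda>h. inner h D)) (at (x + t *\<^sub>R v))"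
    using assms by (simp add: gderiv_def)
  ultimately have "((\<lambda>t. g (x + t *\<^sub>R v)) has_derivative (\<lambda>s. inner (s *\<^sub>R v) D)) (at t)"
    by (rule has_derivative_compose)
  moreover have "(\<lambda>s. inner (s *\<^sub>R v) D) = (*) (inner v D)"
    by (auto simp: mult.commute)
  ultimately show ?thesis
    by (simp add: has_field_derivative_def)
qed

text \<open>Instead of integrating the gradient along the segment, the claimed upper bound is
  subtracted from \<open>g\<close> there. By Cauchy-Schwarz and the Lipschitz gradient the
  difference \<open>h\<close> has nonpositive slope.\<close>

lemma L_smooth_descent:
  assumes "L_smooth L g"
  shows "g y \<le> g x + inner (gradient g x) (y - x) + L / 2 * (norm (y - x))\<^sup>2"
proof -
  define v where "v = y - x"
  define h where "h t = g (x + t *\<^sub>R v) - t * inner v (gradient g x) - L / 2 * t\<^sup>2 * (norm v)\<^sup>2" for t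
  have lip: "L-lipschitz_on UNIV (gradient g)" and diff: "\<And>z. g differentiable (at z)"
    using assms by (auto simp: L_smooth_def)
  have "h 0 \<ge> h 1"
  proof (rule DERIV_nonpos_imp_nonincreasing[of 0 1 h])
    fix t :: real assume t: "0 \<le> t" "t \<le> 1"
    let ?D = "inner v (gradient g (x + t *\<^sub>R v)) - inner v (gradient g x) - L * t * (norm v)\<^sup>2"
    have "DERIV h t :> ?D"
      unfolding h_def
      by (rule derivative_eq_intros GDERIV_imp_DERIV_line differentiable_GDERIV_gradient diff refl
          | simp)+
    moreover have "?D \<le> 0"
    proof -
      have "inner v (gradient g (x + t *\<^sub>R v) - gradient g x)
          \<le> norm v * norm (gradient g (x + t *\<^sub>R v) - gradient g x)"
        by (rule norm_cauchy_schwarz)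
      also have "norm (gradient g (x + t *\<^sub>R v) - gradient g x) \<le> L * norm (t *\<^sub>R v)"
        using lipschitz_onD[OF lip, of "x + t *\<^sub>R v" x] by (simp add: dist_norm)
      finally show ?thesis
        using t by (simp add: inner_diff_right power2_eq_square mult_left_mono mult.left_commute mult.assoc)
    qed
    ultimately show "\<exists>D. DERIV h t :> D \<and> D \<le> 0"
      by blast
  qed simp
  then show ?thesis
    by (simp add: h_def v_def inner_commute)
qed

section \<open>Convergence under the KL property\<close>

lemma concave_on_imp_below_tangent:
  fixes f :: "real \<Rightarrow> real"
  assumes "concave_on A f" and "connected A" and "c \<in> interior A" and "t \<in> A"
    and "(f has_real_derivative f') (at c within A)"
  shows "f t \<le> f c + f' * (t - c)"
  using convex_on_imp_above_tangent[of A "\<lambda>s. - f s" c t "- f'"] assms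
  by (simp add: concave_on_def DERIV_minus)

text \<open>This isolates what the KL argument needs from the algorithm: sufficient decrease, a
  gradient bound by the last step, and bounded iterates. No networks or proximal maps enter.\<close>

lemma KL_descent_convergence:
  fixes F :: "'a::euclidean_space \<Rightarrow> real" and x :: "nat \<Rightarrow> 'a"
  assumes KL: "KL_function F" and bounded: "bounded (range x)"
    and "a > 0" and "b > 0"
    and decrease: "\<And>k. F (x (Suc k)) + a * (norm (x k - x (Suc k)))\<^sup>2 \<le> F (x k)"
    and error: "\<And>k. norm (gradient F (x (Suc k))) \<le> b * norm (x k - x (Suc k))"
  shows "summable (\<lambda>k. norm (x k - x (Suc k))) \<and> (\<exists>xs. x \<longlonglongrightarrow> xs \<and> GDERIV F xs :> 0)"
proof -
  have diff: "\<And>z. F differentiable (at z)" and contg: "continuous_on UNIV (gradient F)"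
    and KLat: "\<And>z. KL_property_at F z"
    using KL by (auto simp: KL_function_def continuously_differentiable_def)
  have contF: "isCont F z" for z
    using diff[of z] by (rule differentiable_imp_continuous_within)
  define d where "d k = norm (x k - x (Suc k))" for k
  have d0: "d k \<ge> 0" for k
    by (simp add: d_def)
  obtain xs r where r: "strict_mono r" and cluster: "(x \<circ> r) \<longlonglongrightarrow> xs"
    using bounded_imp_convergent_subsequence[OF bounded] by blast
  have dec: "decseq (\<lambda>k. F (x k))"
  proof (rule decseq_SucI)
    fix k
    have "0 \<le> a * (norm (x k - x (Suc k)))\<^sup>2"
      using \<open>a > 0\<close> by simp
    then show "F (x (Suc k)) \<le> F (x k)"
      using decrease[of k] by linarith
  qed
  have subF: "(\<lambda>k. F (x (r k))) \<longlonglongrightarrow> F xs"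
    using isCont_tendsto_compose[OF contF cluster] by (simp add: o_def)
  have Fge: "F xs \<le> F (x k)" for k
  proof (rule LIMSEQ_le_const2[OF subF])
    show "\<exists>N. \<forall>n\<ge>N. F (x (r n)) \<le> F (x k)"
      using decseqD[OF dec] seq_suble[OF r] by (meson le_trans)
  qed
  have Flim: "(\<lambda>k. F (x k)) \<longlonglongrightarrow> F xs"
  proof -
    have "convergent (\<lambda>k. F (x k))"
      using decseq_bounded[OF dec] Fge dec
      by (intro Bseq_monoseq_convergent) (auto intro: decseq_imp_monoseq)
    then obtain l where l: "(\<lambda>k. F (x k)) \<longlonglongrightarrow> l"
      by (auto simp: convergent_def)
    then have "(\<lambda>k. F (x (r k))) \<longlonglongrightarrow> l"
      using LIMSEQ_subseq_LIMSEQ[OF l r] by (simp add: o_def)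
    with subF l show ?thesis
      using LIMSEQ_unique by blast
  qed
  have dlim: "d \<longlonglongrightarrow> 0"
  proof -
    have "(\<lambda>k. (F (x k) - F (x (Suc k))) / a) \<longlonglongrightarrow> (F xs - F xs) / a"
      using \<open>a > 0\<close> by (intro tendsto_intros Flim LIMSEQ_Suc[OF Flim]) auto
    then have "(\<lambda>k. (F (x k) - F (x (Suc k))) / a) \<longlonglongrightarrow> 0"
      by simp
    then have "(\<lambda>k. (d k)\<^sup>2) \<longlonglongrightarrow> 0"
    proof (rule tendsto_sandwich[OF _ _ tendsto_const, rotated 2])
      show "\<forall>\<^sub>F k in sequentially. (d k)\<^sup>2 \<le> (F (x k) - F (x (Suc k))) / a"
        using decrease \<open>a > 0\<close>
        by (intro always_eventually) (simp add: d_def field_simps)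
    qed (auto intro!: always_eventually)
    then have "(\<lambda>k. sqrt ((d k)\<^sup>2)) \<longlonglongrightarrow> sqrt 0"
      by (rule tendsto_real_sqrt)
    then show ?thesis
      using d0 by simp
  qed
  have summable_d: "summable d"
  proof (cases "\<exists>K. F (x K) = F xs")
    \<comment> \<open>The KL inequality says nothing at the level \<open>F xs\<close>. Once this
      level is reached, however, sufficient decrease forces every later step to vanish.\<close>
    case True
    then obtain K where K: "F (x K) = F xs"
      by blast
    have "d k = 0" if "k \<ge> K" for k
    proof -
      have "F (x k) = F xs"
        using K decseqD[OF dec that] Fge[of k] by simp
      then have "a * (d k)\<^sup>2 \<le> 0"
        using decrease[of k] Fge[of "Suc k"] by (simp add: d_def)
      then show ?thesis
        using \<open>a > 0\<close> by (simp add: mult_le_0_iff)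
    qed
    then show ?thesis
      by (intro summable_finite[of "{..<K}"]) auto
  next
    case False
    then have pos: "F xs < F (x k)" for k
      using Fge[of k] by (metis order_le_imp_less_or_eq)
    obtain \<zeta> :: ereal and U \<psi> where "0 < \<zeta>" "open U" "xs \<in> U"
      and \<psi>nonneg: "\<forall>s\<in>{s. 0 \<le> s \<and> ereal s < \<zeta>}. 0 \<le> \<psi> s"
      and \<psi>cont: "continuous_on {s. 0 \<le> s \<and> ereal s < \<zeta>} \<psi>"
      and \<psi>conc: "concave_on {s. 0 \<le> s \<and> ereal s < \<zeta>} \<psi>"
      and \<psi>0: "\<psi> 0 = 0"
      and \<psi>C1: "\<psi> C1_differentiable_on {s. 0 < s \<and> ereal s < \<zeta>}"
      and \<psi>pos: "\<forall>s\<in>{s. 0 < s \<and> ereal s < \<zeta>}. 0 < deriv \<psi> s"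
      and \<psi>KL: "\<forall>z\<in>U. F xs < F z \<and> ereal (F z) < ereal (F xs) + \<zeta> \<longrightarrow>
                  deriv \<psi> (F z - F xs) * norm (gradient F z) \<ge> 1"
      using KLat[of xs] unfolding KL_property_at_def by blast
    \<comment> \<open>The endpoint 0 is left out, as the slope of \<psi> may blow up there; in this
      case all gaps \<open>r' k\<close> are positive.\<close>
    define I where "I = {s. 0 < s \<and> ereal s < \<zeta>}"
    have openI: "open I"
      unfolding I_def by (intro open_Collect_conj open_Collect_less continuous_intros)
    have convI: "convex I"
      unfolding is_interval_convex_1[symmetric] is_interval_1 I_def
      by (auto intro: le_less_trans[of "ereal x" "ereal y" \<zeta> for x y])
    have tangent: "\<psi> t \<le> \<psi> s + deriv \<psi> s * (t - s)" if "s \<in> I" "t \<in> I" for s t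
    proof (rule concave_on_imp_below_tangent)
      show "concave_on I \<psi>"
        using \<psi>conc unfolding concave_on_def
        by (rule convex_on_subset[OF _ _ convI]) (auto simp: I_def)
      show "(\<psi> has_real_derivative deriv \<psi> s) (at s within I)"
        using \<psi>C1 that by (auto simp: C1_differentiable_on_eq I_def DERIV_deriv_iff_real_differentiable
            intro: has_field_derivative_at_within)
    qed (use that openI convI in \<open>auto simp: interior_open convex_connected\<close>)
    define r' where "r' k = F (x k) - F xs" for k
    have r'lim: "r' \<longlonglongrightarrow> 0"
      using tendsto_diff[OF Flim tendsto_const[of "F xs"]] by (simp add: r'_def[abs_def])
    have evI: "\<forall>\<^sub>F k in sequentially. r' k \<in> I"
    proof -
      have "(\<lambda>k. ereal (r' k)) \<longlonglongrightarrow> ereal 0"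
        using r'lim by simp
      then have "\<forall>\<^sub>F k in sequentially. ereal (r' k) < \<zeta>"
        using \<open>0 < \<zeta>\<close> by (intro order_tendstoD(2)) (auto simp: zero_ereal_def)
      then show ?thesis
        by (rule eventually_mono) (use pos in \<open>simp add: I_def r'_def\<close>)
    qed
    have \<psi>lim: "(\<lambda>k. \<psi> (r' k)) \<longlonglongrightarrow> 0"
    proof -
      have "(\<lambda>k. \<psi> (r' k)) \<longlonglongrightarrow> \<psi> 0"
      proof (rule continuous_on_tendsto_compose[OF \<psi>cont r'lim])
        show "\<forall>\<^sub>F k in sequentially. r' k \<in> {s. 0 \<le> s \<and> ereal s < \<zeta>}"
          using evI by (rule eventually_mono) (auto simp: I_def)
      qed (use \<open>0 < \<zeta>\<close> in \<open>auto simp: zero_ereal_def\<close>)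
      then show ?thesis
        by (simp add: \<psi>0)
    qed
    \<comment> \<open>\<open>T k\<close> is the last step length plus the scaled \<psi>-value still
      to be spent; its decrease will pay for the next step.\<close>
    define T where "T k = d k + b / a * \<psi> (r' (Suc k))" for k
    have gap: "d (Suc k) \<le> T k - T (Suc k)"
      if U: "x (Suc k) \<in> U" and I: "r' (Suc k) \<in> I" "r' (Suc (Suc k)) \<in> I" for k
    proof -
      let ?D = "deriv \<psi> (r' (Suc k))" and ?\<Delta> = "\<psi> (r' (Suc k)) - \<psi> (r' (Suc (Suc k)))"
      have Dpos: "?D > 0"
        using I(1) \<psi>pos by (simp add: I_def)
      have "ereal (F (x (Suc k))) < ereal (F xs) + \<zeta>"
        using I(1) by (cases \<zeta>) (auto simp: I_def r'_def)
      then have "1 \<le> ?D * norm (gradient F (x (Suc k)))"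
        using \<psi>KL U pos by (simp add: r'_def)
      also have "\<dots> \<le> ?D * (b * d k)"
        using error[of k] Dpos by (simp add: d_def)
      finally have kl: "1 \<le> ?D * (b * d k)" .
      have "?D * (a * (d (Suc k))\<^sup>2) \<le> ?D * (r' (Suc k) - r' (Suc (Suc k)))"
        using decrease[of "Suc k"] Dpos by (simp add: d_def r'_def)
      also have "\<dots> \<le> ?\<Delta>"
        using tangent[OF I] by (simp add: algebra_simps)
      finally have conc: "?D * (a * (d (Suc k))\<^sup>2) \<le> ?\<Delta>" .
      \<comment> \<open>Multiplying by the KL factor, which is at least 1, brings in
        \<open>?D\<close>, which the concavity estimate \<open>conc\<close> then absorbs: no
        derivative of \<psi> survives in \<open>sq\<close>.\<close>
      have "a * (d (Suc k))\<^sup>2 * 1 \<le> a * (d (Suc k))\<^sup>2 * (?D * (b * d k))"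
        using kl \<open>a > 0\<close> by (intro mult_left_mono) auto
      also have "\<dots> = (?D * (a * (d (Suc k))\<^sup>2)) * (b * d k)"
        by (simp add: algebra_simps)
      also have "\<dots> \<le> ?\<Delta> * (b * d k)"
        using conc d0 \<open>b > 0\<close> by (intro mult_right_mono) auto
      finally have sq: "(d (Suc k))\<^sup>2 \<le> d k * (b / a * ?\<Delta>)"
        using \<open>a > 0\<close> by (simp add: field_simps)
      have "0 \<le> ?D * (a * (d (Suc k))\<^sup>2)"
        using Dpos \<open>a > 0\<close> by simp
      then have \<Delta>: "0 \<le> b / a * ?\<Delta>"
        using conc \<open>a > 0\<close> \<open>b > 0\<close> by simp
      have "d (Suc k) \<le> sqrt (d k * (b / a * ?\<Delta>))"
        using sq by (rule real_le_rsqrt)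
      also have "\<dots> \<le> (d k + b / a * ?\<Delta>) / 2"
        using d0 \<Delta> by (rule arith_geo_mean_sqrt)
      finally show ?thesis
        by (simp add: T_def algebra_simps)
    qed
    have Tlim: "T \<longlonglongrightarrow> 0"
      using tendsto_add[OF dlim tendsto_mult_left[OF LIMSEQ_Suc[OF \<psi>lim], of "b / a"]]
      by (simp add: T_def[abs_def])
    obtain \<rho> where "\<rho> > 0" and \<rho>: "\<And>z. dist z xs < \<rho> \<Longrightarrow> z \<in> U"
      using \<open>open U\<close> \<open>xs \<in> U\<close> unfolding open_dist by blast
    \<comment> \<open>One third of \<rho> each goes to the distance of \<open>x K\<close> from
      \<open>xs\<close>, to the step \<open>d K\<close> and to \<open>T K\<close>. Only the
      subsequence is known to approach \<open>xs\<close> so far, so \<open>K\<close> is taken from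
      it.\<close>
    obtain N where N: "\<And>k. k \<ge> N \<Longrightarrow> r' k \<in> I" "\<And>k. k \<ge> N \<Longrightarrow> T k < \<rho> / 3"
        "\<And>k. k \<ge> N \<Longrightarrow> d k < \<rho> / 3"
    proof -
      have "\<forall>\<^sub>F k in sequentially. r' k \<in> I \<and> T k < \<rho> / 3 \<and> d k < \<rho> / 3"
        using \<open>\<rho> > 0\<close> by (intro eventually_conj evI order_tendstoD(2)[OF Tlim]
            order_tendstoD(2)[OF dlim]) auto
      then show ?thesis
        using that by (auto simp: eventually_sequentially)
    qed
    obtain K where "K \<ge> N" and K: "dist (x K) xs < \<rho> / 3"
    proof -
      have "\<forall>\<^sub>F k in sequentially. dist (x (r k)) xs < \<rho> / 3"
        using tendstoD[OF cluster, of "\<rho> / 3"] \<open>\<rho> > 0\<close> by simp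
      moreover have "\<forall>\<^sub>F k in sequentially. k \<ge> N"
        by (rule eventually_ge_at_top)
      ultimately have "\<forall>\<^sub>F k in sequentially. dist (x (r k)) xs < \<rho> / 3 \<and> k \<ge> N"
        by (rule eventually_conj)
      then obtain k where "dist (x (r k)) xs < \<rho> / 3" "k \<ge> N"
        by (auto simp: eventually_sequentially)
      then show ?thesis
        using that[of "r k"] seq_suble[OF r, of k] by linarith
    qed
    have Tnn: "0 \<le> T k" if "k \<ge> N" for k
      using N(1)[of "Suc k"] that \<psi>nonneg d0[of k] \<open>a > 0\<close> \<open>b > 0\<close> by (auto simp: T_def I_def)
    have trapped: "dist (x (Suc k)) xs + T k < \<rho>" if "k \<ge> K" for k
      using that
    proof (induction rule: dec_induct)
      case base
      have "dist (x (Suc K)) xs \<le> dist (x K) xs + d K"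
        using dist_triangle[of "x (Suc K)" xs "x K"] by (simp add: d_def dist_norm norm_minus_commute)
      then show ?case
        using K N(2,3)[OF \<open>K \<ge> N\<close>] by linarith
    next
      \<comment> \<open>Keeping \<open>T n\<close> in the invariant closes the induction: the next
        move is at most the loss in \<open>T\<close>. Nonnegativity of \<open>T n\<close> yields
        membership in \<open>U\<close>.\<close>
      case (step n)
      have "n \<ge> N"
        using step.hyps \<open>K \<ge> N\<close> by simp
      then have "x (Suc n) \<in> U"
        using step.IH Tnn[of n] by (intro \<rho>) linarith
      then have "d (Suc n) \<le> T n - T (Suc n)"
        using N(1) \<open>n \<ge> N\<close> by (intro gap) simp_all
      moreover have "dist (x (Suc (Suc n))) xs \<le> dist (x (Suc n)) xs + d (Suc n)"
        using dist_triangle[of "x (Suc (Suc n))" xs "x (Suc n)"]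
        by (simp add: d_def dist_norm norm_minus_commute)
      ultimately show ?case
        using step.IH by linarith
    qed
    have dT: "d (Suc k) \<le> T k - T (Suc k)" if "k \<ge> K" for k
    proof (rule gap)
      show "x (Suc k) \<in> U"
        using trapped[OF that] Tnn[of k] that \<open>K \<ge> N\<close> by (intro \<rho>) linarith
    qed (use N(1) that \<open>K \<ge> N\<close> in auto)
    have "summable (\<lambda>k. d (Suc k))"
      using dT d0 by (intro summable_comparison_test'[OF telescope_summable'[OF Tlim], of K]) auto
    then show ?thesis
      by (simp only: summable_Suc_iff)
  qed
  have xlim: "x \<longlonglongrightarrow> xs"
  proof -
    have "summable (\<lambda>k. x k - x (Suc k))"
      using summable_d unfolding d_def by (rule summable_norm_cancel)
    then have "convergent (\<lambda>n. \<Sum>k<n. x k - x (Suc k))"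
      by (simp add: summable_iff_convergent)
    then have "convergent (\<lambda>n. x 0 - (\<Sum>k<n. x k - x (Suc k)))"
      by (intro convergent_diff convergent_const)
    then have "convergent x"
      by (simp add: sum_lessThan_telescope')
    then obtain l where l: "x \<longlonglongrightarrow> l"
      by (auto simp: convergent_def)
    with cluster LIMSEQ_subseq_LIMSEQ[OF l r] show ?thesis
      using LIMSEQ_unique by blast
  qed
  have "gradient F xs = 0"
  proof (rule LIMSEQ_unique)
    show "(\<lambda>k. gradient F (x (Suc k))) \<longlonglongrightarrow> gradient F xs"
      by (rule continuous_on_tendsto_compose[OF contg LIMSEQ_Suc[OF xlim]]) auto
    show "(\<lambda>k. gradient F (x (Suc k))) \<longlonglongrightarrow> 0"
    proof (rule Lim_null_comparison)
      show "\<forall>\<^sub>F k in sequentially. norm (gradient F (x (Suc k))) \<le> b * d k"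
        using error unfolding d_def by (intro always_eventually allI)
      show "(\<lambda>k. b * d k) \<longlonglongrightarrow> 0"
        using tendsto_mult_left[OF dlim, of b] by simp
    qed
  qed
  then have "GDERIV F xs :> 0"
    using differentiable_GDERIV_gradient[OF diff, of xs] by simp
  then show ?thesis
    using summable_d xlim unfolding d_def by blast
qed

section \<open>The implicit regularizer\<close>

text \<open>A Lipschitz activation preserves affine bounds in \<open>norm x\<close>, layer by layer.
  The bound is what the quadratic term must beat in
  \<open>implicit_regularizer_coercive\<close>.\<close>

lemma icnn_layer_linear_growth:
  fixes \<theta> :: "'n::finite icnn"
  assumes lip: "L-lipschitz_on UNIV (icnn_act \<theta>)"
  shows "\<exists>A B. 0 \<le> B \<and> (\<forall>x. \<bar>icnn_layer \<theta> x i j\<bar> \<le> A + B * norm x)"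
proof (induction i arbitrary: j)
  case 0
  show ?case
    by (rule exI[of _ 0], rule exI[of _ 0]) simp
next
  case (Suc i)
  then obtain A B where B: "\<And>k. 0 \<le> B k"
    and AB: "\<And>k x. \<bar>icnn_layer \<theta> x i k\<bar> \<le> A k + B k * norm x"
    by metis
  have "L \<ge> 0"
    using lip by (rule lipschitz_on_nonneg)
  let ?w = "\<lambda>k. \<bar>icnn_W \<theta> i j k\<bar>" and ?K = "{..<icnn_width \<theta> i}"
  define A' where "A' = \<bar>icnn_act \<theta> 0\<bar> + L * ((\<Sum>k\<in>?K. ?w k * A k) + \<bar>icnn_b \<theta> i j\<bar>)"
  define B' where "B' = L * ((\<Sum>k\<in>?K. ?w k * B k) + norm (icnn_H \<theta> i j))"
  have "\<bar>icnn_layer \<theta> x (Suc i) j\<bar> \<le> A' + B' * norm x" for x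
  proof -
    define s where "s = (\<Sum>k\<in>?K. icnn_W \<theta> i j k * icnn_layer \<theta> x i k)"
    define t where "t = s + inner (icnn_H \<theta> i j) x + icnn_b \<theta> i j"
    have "\<bar>s\<bar> \<le> (\<Sum>k\<in>?K. ?w k * (A k + B k * norm x))"
      unfolding s_def using AB
      by (intro order_trans[OF sum_abs] sum_mono) (simp add: abs_mult mult_left_mono)
    also have "\<dots> = (\<Sum>k\<in>?K. ?w k * A k) + (\<Sum>k\<in>?K. ?w k * B k) * norm x"
      by (simp add: sum.distrib sum_distrib_right distrib_left mult.assoc)
    finally have "\<bar>t\<bar> \<le> (\<Sum>k\<in>?K. ?w k * A k) + (\<Sum>k\<in>?K. ?w k * B k) * norm x
        + norm (icnn_H \<theta> i j) * norm x + \<bar>icnn_b \<theta> i j\<bar>"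
      using Cauchy_Schwarz_ineq2[of "icnn_H \<theta> i j" x] unfolding t_def by linarith
    then have "L * \<bar>t\<bar> \<le> L * ((\<Sum>k\<in>?K. ?w k * A k) + (\<Sum>k\<in>?K. ?w k * B k) * norm x
        + norm (icnn_H \<theta> i j) * norm x + \<bar>icnn_b \<theta> i j\<bar>)"
      using \<open>L \<ge> 0\<close> by (rule mult_left_mono)
    moreover have "\<bar>icnn_act \<theta> t - icnn_act \<theta> 0\<bar> \<le> L * \<bar>t\<bar>"
      using lipschitz_onD[OF lip, of t 0] by (simp add: dist_real_def)
    ultimately show ?thesis
      by (simp add: A'_def B'_def t_def s_def algebra_simps)
  qed
  moreover have "0 \<le> B'"
    using B \<open>L \<ge> 0\<close> by (auto simp: B'_def intro!: mult_nonneg_nonneg add_nonneg_nonneg sum_nonneg)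
  ultimately show ?case
    by blast
qed

lemma lpn_fenchel_young:
  assumes "is_LPN \<theta> \<alpha> f"
  shows "inner y z - lpn_potential \<theta> \<alpha> y \<le> implicit_regularizer \<theta> \<alpha> z + 1 / 2 * (norm z)\<^sup>2"
proof -
  have "ereal (inner y z - lpn_potential \<theta> \<alpha> y) \<le> convex_conjugate (lpn_potential \<theta> \<alpha>) z"
    unfolding convex_conjugate_def by (rule SUP_upper) simp
  then show ?thesis
    using convex_conjugate_lpn_finite[OF assms, of z]
    by (auto simp: implicit_regularizer_def)
qed

text \<open>Since \<open>f y\<close> is a subgradient of the potential at \<open>y\<close>, the
  supremum defining the conjugate at \<open>f y\<close> is attained at \<open>y\<close>.\<close>

lemma lpn_fenchel_equality:
  assumes lpn: "is_LPN \<theta> \<alpha> f"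
  shows "implicit_regularizer \<theta> \<alpha> (f y) + 1 / 2 * (norm (f y))\<^sup>2
    = inner y (f y) - lpn_potential \<theta> \<alpha> y"
proof -
  obtain v where v: "f y = v + \<alpha> *\<^sub>R y" "v \<in> subdifferential (icnn_fun \<theta>) y" and "0 < \<alpha>"
    using lpn unfolding is_LPN_def by blast
  have "inner u (f y) - lpn_potential \<theta> \<alpha> u \<le> inner y (f y) - lpn_potential \<theta> \<alpha> y" for u
  proof -
    have "icnn_fun \<theta> u \<ge> icnn_fun \<theta> y + inner v (u - y)"
      using v(2) by (simp add: subdifferential_def)
    \<comment> \<open>This square is the gap between \<open>\<alpha> / 2 * (norm u)\<^sup>2\<close>
      and its linearisation at \<open>y\<close>.\<close>
    moreover have "0 \<le> \<alpha> / 2 * (norm (u - y))\<^sup>2"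
      using \<open>0 < \<alpha>\<close> by simp
    ultimately show ?thesis
      unfolding v(1) lpn_potential_def power2_norm_eq_inner
      by (simp add: inner_add_right inner_diff_left inner_diff_right inner_commute algebra_simps)
  qed
  then have "convex_conjugate (lpn_potential \<theta> \<alpha>) (f y) \<le> ereal (inner y (f y) - lpn_potential \<theta> \<alpha> y)"
    unfolding convex_conjugate_def by (intro SUP_least) simp
  then have "implicit_regularizer \<theta> \<alpha> (f y) + 1 / 2 * (norm (f y))\<^sup>2
      \<le> inner y (f y) - lpn_potential \<theta> \<alpha> y"
    using convex_conjugate_lpn_finite[OF lpn, of "f y"]
    by (auto simp: implicit_regularizer_def)
  with lpn_fenchel_young[OF lpn, of y "f y"] show ?thesis
    by simp
qed

text \<open>Subtracting Fenchel's equality from the Fenchel-Young inequality cancels the potential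
  at \<open>y\<close>; adding half the squared norm of \<open>y\<close> completes both
  squares.\<close>

lemma lpn_is_prox:
  assumes lpn: "is_LPN \<theta> \<alpha> f"
  shows "implicit_regularizer \<theta> \<alpha> (f y) + 1 / 2 * (norm (f y - y))\<^sup>2
    \<le> implicit_regularizer \<theta> \<alpha> z + 1 / 2 * (norm (z - y))\<^sup>2"
  using lpn_fenchel_equality[OF lpn, of y] lpn_fenchel_young[OF lpn, of y z]
  unfolding power2_norm_eq_inner
  by (simp add: inner_diff_left inner_diff_right inner_commute algebra_simps)

lemma implicit_regularizer_coercive:
  assumes lpn: "is_LPN \<theta> \<alpha> f"
  shows "\<exists>c A. c > 0 \<and> (\<forall>z. c * (norm z)\<^sup>2 - A \<le> implicit_regularizer \<theta> \<alpha> z)"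
proof -
  obtain L where "L-lipschitz_on UNIV (icnn_act \<theta>)"
    using lpn unfolding is_LPN_def by blast
  then obtain A B where AB: "\<And>x. \<bar>icnn_fun \<theta> x\<bar> \<le> A + B * norm x"
    using icnn_layer_linear_growth unfolding icnn_fun_def by metis
  \<comment> \<open>Testing the conjugate at \<open>z\<close> itself leaves the coefficient
    \<open>(1 - \<alpha>) / 2\<close> on the squared norm. Half of it is kept, the other half
    absorbs the linear growth of the network.\<close>
  define c where "c = (1 - \<alpha>) / 4"
  have "c > 0"
    using lpn by (simp add: is_LPN_def c_def)
  have "c * (norm z)\<^sup>2 - (A + B\<^sup>2 / (4 * c)) \<le> implicit_regularizer \<theta> \<alpha> z" for z
  proof -
    have "0 \<le> (2 * c * norm z - B)\<^sup>2 / (4 * c)"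
      using \<open>c > 0\<close> by simp
    also have "\<dots> = c * (norm z)\<^sup>2 - B * norm z + B\<^sup>2 / (4 * c)"
      using \<open>c > 0\<close> by (simp add: field_simps power2_eq_square)
    finally have "B * norm z \<le> c * (norm z)\<^sup>2 + B\<^sup>2 / (4 * c)"
      by simp
    moreover have "2 * c * (norm z)\<^sup>2 - icnn_fun \<theta> z \<le> implicit_regularizer \<theta> \<alpha> z"
      using lpn_fenchel_young[OF lpn, of z z]
      by (simp add: lpn_potential_def c_def power2_norm_eq_inner field_simps)
    ultimately show ?thesis
      using AB[of z] by linarith
  qed
  with \<open>c > 0\<close> show ?thesis
    by blast
qed

section \<open>Proximal gradient descent\<close>

theorem proposition4p4:
  fixes \<theta> :: "'n::finite icnn" and \<alpha> :: real and f :: "real ^ 'n \<Rightarrow> real ^ 'n"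
    and fid :: "real ^ 'n \<Rightarrow> real" and L \<eta> :: real
    and x0 :: "real ^ 'n" and x :: "nat \<Rightarrow> real ^ 'n" and F :: "real ^ 'n \<Rightarrow> real"
  assumes "is_LPN \<theta> \<alpha> f"
    and "L > 0" and "L_smooth L fid" and "bdd_below (range fid)"
    and "0 < \<eta>" and "\<eta> < 1 / L"
    and "x 0 = x0"
    and "\<And>k. x (Suc k) = f (x k - \<eta> *\<^sub>R gradient fid (x k))"
    and "F = (\<lambda>y. \<eta> * fid y + implicit_regularizer \<theta> \<alpha> y)"
  shows "decseq (\<lambda>k. F (x k)) \<and> convergent (\<lambda>k. F (x k))
    \<and> summable (\<lambda>k. (norm (x (Suc k) - x (Suc (Suc k))))\<^sup>2)
    \<and> (KL_function F \<longrightarrow>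
         summable (\<lambda>k. norm (x (Suc k) - x (Suc (Suc k))))
         \<and> (\<exists>xs. x \<longlonglongrightarrow> xs \<and> GDERIV F xs :> 0))"
proof -
  note lpn = assms(1) and smooth = assms(3) and F_def = assms(9)
  let ?\<phi> = "implicit_regularizer \<theta> \<alpha>" and ?g = "gradient fid"
  define y where "y k = x k - \<eta> *\<^sub>R ?g (x k)" for k
  \<comment> \<open>The proximal step gains \<open>1 / 2\<close> of the squared step, and the
    descent lemma, scaled by \<eta>, costs \<open>\<eta> * L / 2\<close> of it.\<close>
  define a where "a = (1 - \<eta> * L) / 2"
  have "a > 0"
    using assms(2,6) by (simp add: a_def field_simps)
  have xSuc: "x (Suc k) = f (y k)" for k
    using assms(8) by (simp add: y_def)
  have prox: "?\<phi> (x (Suc k)) + 1 / 2 * (norm (x (Suc k) - y k))\<^sup>2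
      \<le> ?\<phi> z + 1 / 2 * (norm (z - y k))\<^sup>2" for k z
    unfolding xSuc by (rule lpn_is_prox[OF lpn])
  have decrease: "F (x (Suc k)) + a * (norm (x k - x (Suc k)))\<^sup>2 \<le> F (x k)" for k
  proof -
    let ?d = "x (Suc k) - x k"
    have "\<eta> * fid (x (Suc k)) \<le> \<eta> * (fid (x k) + inner (?g (x k)) ?d + L / 2 * (norm ?d)\<^sup>2)"
      using L_smooth_descent[OF smooth] assms(5) by (intro mult_left_mono) auto
    moreover have "?\<phi> (x (Suc k)) + 1 / 2 * (norm ?d)\<^sup>2 + \<eta> * inner (?g (x k)) ?d \<le> ?\<phi> (x k)"
      using prox[of k "x k"] unfolding y_def power2_norm_eq_inner
      by (simp add: inner_diff_left inner_diff_right inner_commute algebra_simps)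
    ultimately show ?thesis
      unfolding F_def a_def norm_minus_commute[of "x k"] by (simp add: field_simps)
  qed
  have dec: "decseq (\<lambda>k. F (x k))"
  proof (rule decseq_SucI)
    fix k
    have "0 \<le> a * (norm (x k - x (Suc k)))\<^sup>2"
      using \<open>a > 0\<close> by simp
    then show "F (x (Suc k)) \<le> F (x k)"
      using decrease[of k] by linarith
  qed
  obtain m where m: "\<And>z. m \<le> fid z"
    using assms(4) by (auto simp: bdd_below_def)
  obtain c A where "c > 0" and c: "\<And>z. c * (norm z)\<^sup>2 - A \<le> ?\<phi> z"
    using implicit_regularizer_coercive[OF lpn] by blast
  have coercive: "c * (norm z)\<^sup>2 + (\<eta> * m - A) \<le> F z" for z
    using mult_left_mono[OF m[of z], of \<eta>] assms(5) c[of z] unfolding F_def by linarith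
  have Fge: "\<eta> * m - A \<le> F z" for z
    using coercive[of z] \<open>c > 0\<close> by (smt (verit) mult_nonneg_nonneg zero_le_power2)
  have conv: "convergent (\<lambda>k. F (x k))"
    using decseq_bounded[OF dec] Fge dec
    by (intro Bseq_monoseq_convergent) (auto intro: decseq_imp_monoseq)
  have sq: "summable (\<lambda>k. (norm (x k - x (Suc k)))\<^sup>2)"
  proof (rule summable_comparison_test')
    obtain l where "(\<lambda>k. F (x k)) \<longlonglongrightarrow> l"
      using conv by (auto simp: convergent_def)
    then show "summable (\<lambda>k. (F (x k) - F (x (Suc k))) / a)"
      by (intro summable_divide telescope_summable')
    show "norm ((norm (x k - x (Suc k)))\<^sup>2) \<le> (F (x k) - F (x (Suc k))) / a" for k
      using decrease[of k] \<open>a > 0\<close> by (simp add: field_simps)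
  qed
  have KL: "summable (\<lambda>k. norm (x k - x (Suc k))) \<and> (\<exists>xs. x \<longlonglongrightarrow> xs \<and> GDERIV F xs :> 0)"
    if "KL_function F"
  proof (rule KL_descent_convergence[where F = F and a = a and b = "1 + \<eta> * L"])
    \<comment> \<open>The iterates stay in the sublevel set of \<open>F (x 0)\<close>, which is
      bounded by coercivity.\<close>
    have "norm (x k) \<le> sqrt ((F (x 0) - (\<eta> * m - A)) / c)" for k
      using coercive[of "x k"] decseqD[OF dec, of 0 k] \<open>c > 0\<close>
      by (intro real_le_rsqrt) (simp add: field_simps)
    then show "bounded (range x)"
      by (auto simp: bounded_iff)
    show "F (x (Suc k)) + a * (norm (x k - x (Suc k)))\<^sup>2 \<le> F (x k)" for k
      by (rule decrease)
    show "1 + \<eta> * L > 0"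
      using assms(2,5) by (simp add: add_pos_pos)
    show "norm (gradient F (x (Suc k))) \<le> (1 + \<eta> * L) * norm (x k - x (Suc k))" for k
    proof -
      let ?z = "x (Suc k)"
      have dF: "(F has_derivative (\<lambda>h. inner h (gradient F ?z))) (at ?z)"
        using that differentiable_GDERIV_gradient
        by (auto simp: KL_function_def continuously_differentiable_def gderiv_def)
      have dfid: "(fid has_derivative (\<lambda>h. inner h (?g ?z))) (at ?z)"
        using smooth differentiable_GDERIV_gradient by (auto simp: L_smooth_def gderiv_def)
      \<comment> \<open>This is the proximal objective with the regularizer written as
        \<open>F - \<eta> * fid\<close>, so that its differentiability follows from that of
        \<open>F\<close>, which is part of \<open>KL_function\<close>. Fermat's rule at the
        minimiser \<open>?z\<close> then gives the gradient of \<open>F\<close>.\<close>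
      let ?G = "\<lambda>z. F z - \<eta> * fid z + 1 / 2 * inner (z - y k) (z - y k)"
      have "(?G has_derivative (\<lambda>h. inner h (gradient F ?z) - \<eta> * inner h (?g ?z)
          + 1 / 2 * (inner (?z - y k) h + inner h (?z - y k)))) (at ?z)"
        by (rule dF dfid derivative_eq_intros refl | simp)+
      moreover have "\<forall>z\<in>UNIV. ?G ?z \<le> ?G z"
        using prox[of k] by (simp add: F_def power2_norm_eq_inner)
      ultimately have "(\<lambda>h. inner h (gradient F ?z) - \<eta> * inner h (?g ?z)
          + 1 / 2 * (inner (?z - y k) h + inner h (?z - y k))) = (\<lambda>h. 0)"
        by (intro differential_zero_maxmin[of ?z UNIV]) auto
      then have "inner h (gradient F ?z - \<eta> *\<^sub>R ?g ?z + (?z - y k)) = 0" for h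
        by (drule_tac fun_cong[of _ _ h])
          (simp add: inner_add_right inner_diff_right inner_diff_left inner_commute algebra_simps)
      then have "gradient F ?z - \<eta> *\<^sub>R ?g ?z + (?z - y k) = 0"
        using inner_eq_zero_iff by blast
      \<comment> \<open>Expanding \<open>y k\<close> pairs the two gradients of \<open>fid\<close>:
        their difference contributes \<open>\<eta> * L\<close> to the error constant, the
        displacement contributes 1.\<close>
      then have "gradient F ?z = \<eta> *\<^sub>R (?g ?z - ?g (x k)) + (x k - ?z)"
        by (simp add: y_def algebra_simps)
      then have "norm (gradient F ?z) \<le> \<eta> * norm (?g ?z - ?g (x k)) + norm (x k - ?z)"
        using norm_triangle_ineq[of "\<eta> *\<^sub>R (?g ?z - ?g (x k))" "x k - ?z"] assms(5) by simp
      also have "norm (?g ?z - ?g (x k)) \<le> L * norm (x k - ?z)"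
        using smooth lipschitz_onD[of L UNIV ?g ?z "x k"]
        by (simp add: L_smooth_def dist_norm norm_minus_commute)
      finally show ?thesis
        using assms(5) by (simp add: algebra_simps)
    qed
  qed (use that \<open>a > 0\<close> in auto)
  \<comment> \<open>The sums in the theorem start at index 1, so the first term is dropped.\<close>
  show ?thesis
    using dec conv sq KL summable_Suc_iff[of "\<lambda>k. (norm (x k - x (Suc k)))\<^sup>2"]
      summable_Suc_iff[of "\<lambda>k. norm (x k - x (Suc k))"] by blast
qed

end
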